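(* Let $\mu=(\mu_n)_{n\in\mathbb{N}_0}$ be a probability vector with $\mu_0\in(0,1)$. Then the following statements are equivalent: (a) There exists $n\in\mathbb{N}$ such that $\# V_\mu^c(\mathbb{N}_0^n)<\infty$ almost surely. (b) For all $n\in\mathbb{N}$, $\# V_\mu^c(\mathbb{N}_0^n)<\infty$ almost surely. (c) The Markov chain $(X_m)_{m\ge 0}$ (the random exchange process associated with $\mu$) is transient. (d) $\displaystyle\sum_{m\ge 0}\ \prod_{k=1}^{m}\ \sum_{l=0}^{k-1}\mu_l<\infty$. Moreover, if one of these conditions is satisfied, then $\mathbb{E}[\# V_\mu^c(\mathbb{N}_0^n)]<\infty$ for all $n\in\mathbb{N}$, and there exists $\alpha\in(0,\infty)$ with $\mathbb{E}[\exp(\alpha\,\# V_\mu^c(\mathbb{N}_0))]<\infty$.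
   Context: Notation: $\mathbb{N}=\{1,2,\ldots\}$, $\mathbb{N}_0=\{0,1,2,\ldots\}$, and $\#A\in\mathbb{N}_0\cup\{\infty\}$ is the cardinality of a (countable) set $A$. Percolation model. Let $\mathcal{G}=(V,E)$ be a directed graph with countably infinite vertex set $V$. For $x,y\in V$, $d(x,y)\in\mathbb{N}_0\cup\{\infty\}$ is the length of a shortest directed path from $x$ to $y$ in $\mathcal{G}$ ($\infty$ if there is none; $d(x,x)=0$). For $x\in V$ and $k\in\mathbb{N}_0$, let $B_k(x)=\{y\in V : d(x,y)<k\}$ (so $B_0(x)=\emptyset$). Let $(Y_x)_{x\in V}$ be i.i.d. random variables with $\mathbb{P}[Y_x=k]=\mu_k$ for all $k\ge 0$. The random sets of covered and uncovered vertices are $$V_\mu(\mathcal{G})=\bigcup_{x\in V}B_{Y_x}(x),\qquad V_\mu^c(\mathcal{G})=V\setminus V_\mu(\mathcal{G}).$$ The directed lattice: for $n\in\mathbb{N}$, $\mathbb{N}_0^n$ also denotes the directed graph with vertex set $\mathbb{N}_0^n$ and edge set consisting of all pairs $(x,x+e_j)$ with $x\in\mathbb{N}_0^n$, $j\in\{1,\ldots,n\}$, where $e_j$ is the $j$-th standard unit vector. $\mathbb{N}_0$ denotes the case $n=1$. Random exchange process. Let $(Y_m)_{m\ge 0}$ be i.i.d. random variables with law $\mu$, set $X_0:=Y_0$ and $X_{m+1}:=\max\{X_m-1,\,Y_{m+1}\}$ for $m\in\mathbb{N}_0$. This is a time-homogeneous Markov chain, irreducible on its state space $\mathcal{X}$,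 where $\mathcal{X}=\mathbb{N}_0$ if $\mu$ has unbounded support, and $\mathcal{X}=\{0,1,\ldots,n_0\}$ with $n_0=\sup\{k\in\mathbb{N}:\mu_k\neq 0\}$ otherwise. An empty product equals $1$. *)

theory Defs
  imports "HOL-Probability.Probability" "HOL-Library.Extended_Nat"
begin

section \<open>Distance balls in directed graphs\<close>

(* A directed graph is a vertex set V together with an edge relation E. The infimum over the
   empty set is infinity in enat, which gives distance infinity when there is no path. *)
definition graph_dist :: "('v \<times> 'v) set \<Rightarrow> 'v \<Rightarrow> 'v \<Rightarrow> enat" where
  "graph_dist E x y = (INF k \<in> {k. (x, y) \<in> E ^^ k}. enat k)"

definition graph_ball :: "'v set \<Rightarrow> ('v \<times> 'v) set \<Rightarrow> nat \<Rightarrow> 'v \<Rightarrow> 'v set" where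
  "graph_ball V E k x = {y \<in> V. graph_dist E x y < enat k}"

definition covered :: "'v set \<Rightarrow> ('v \<times> 'v) set \<Rightarrow> ('v \<Rightarrow> nat) \<Rightarrow> 'v set" where
  "covered V E r = (\<Union>x\<in>V. graph_ball V E (r x) x)"

definition uncovered :: "'v set \<Rightarrow> ('v \<times> 'v) set \<Rightarrow> ('v \<Rightarrow> nat) \<Rightarrow> 'v set" where
  "uncovered V E r = V - covered V E r"

section \<open>The directed lattice\<close>

(* Points of the n-dimensional lattice are lists of n natural numbers. *)
definition lattice_verts :: "nat \<Rightarrow> nat list set" where
  "lattice_verts n = {x. length x = n}"

definition lattice_edges :: "nat \<Rightarrow> (nat list \<times> nat list) set" where
  "lattice_edges n = {(x, x[j := Suc (x ! j)]) | x j. x \<in> lattice_verts n \<and> j < n}"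

definition lattice_uncovered :: "nat \<Rightarrow> (nat list \<Rightarrow> nat) \<Rightarrow> nat list set" where
  "lattice_uncovered n r = uncovered (lattice_verts n) (lattice_edges n) r"

section \<open>Extended cardinality\<close>

definition ext_card :: "'a set \<Rightarrow> enat" where
  "ext_card A = (if finite A then enat (card A) else \<infinity>)"

(* exp (a * c), with value infinity at c = infinity; only used for a > 0. *)
definition exp_mult_enat :: "real \<Rightarrow> enat \<Rightarrow> ennreal" where
  "exp_mult_enat a c = (case c of enat k \<Rightarrow> ennreal (exp (a * real k)) | \<infinity> \<Rightarrow> \<infinity>)"

section \<open>Families of i.i.d. random variables\<close>

definition iid_with_law :: "'a measure \<Rightarrow> nat pmf \<Rightarrow> 'i set \<Rightarrow> ('i \<Rightarrow> 'a \<Rightarrow> nat) \<Rightarrow> bool" where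
  "iid_with_law M \<mu> I Y \<longleftrightarrow>
     prob_space M \<and>
     prob_space.indep_vars M (\<lambda>_. count_space UNIV) Y I \<and>
     (\<forall>i\<in>I. \<forall>k. \<P>(\<omega> in M. Y i \<omega> = k) = pmf \<mu> k)"

section \<open>The random exchange process\<close>

(* Truncated subtraction is harmless: the maximum with a natural number is the same
   whether 0 - 1 is read as 0 or as -1. *)
primrec exchange_process :: "(nat \<Rightarrow> 'a \<Rightarrow> nat) \<Rightarrow> nat \<Rightarrow> 'a \<Rightarrow> nat" where
  "exchange_process Y 0 \<omega> = Y 0 \<omega>"
| "exchange_process Y (Suc m) \<omega> = max (exchange_process Y m \<omega> - 1) (Y (Suc m) \<omega>)"

definition exchange_states :: "nat pmf \<Rightarrow> nat set" where
  "exchange_states \<mu> = (if finite (set_pmf \<mu>) then {0..Max (set_pmf \<mu>)} else UNIV)"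

(* For a time-homogeneous Markov chain X, the conditional probability below does not depend on
   the time m at which x is visited: it is the probability, for the chain started in x, of ever
   returning to x. The initial law need not charge x, hence the conditioning at an arbitrary
   time m with P (X m = x) > 0. *)
definition transient_state :: "'a measure \<Rightarrow> (nat \<Rightarrow> 'a \<Rightarrow> 's) \<Rightarrow> 's \<Rightarrow> bool" where
  "transient_state M X x \<longleftrightarrow>
     (\<forall>m. \<P>(\<omega> in M. X m \<omega> = x) > 0 \<longrightarrow>
        \<P>(\<omega> in M. \<exists>k\<ge>1. X (m + k) \<omega> = x \<bar> X m \<omega> = x) < 1)"

(* S is the state space; transience is meant for chains that visit every state of S with
   positive probability, in particular for chains that are irreducible on S. *)
definition transient_chain :: "'a measure \<Rightarrow> 's set \<Rightarrow> (nat \<Rightarrow> 'a \<Rightarrow> 's) \<Rightarrow> bool" where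
  "transient_chain M S X \<longleftrightarrow> (\<forall>x\<in>S. transient_state M X x)"

end

theory Submission
  imports Defs
begin

text \<open>
  The half-line decides everything. Vertex \<open>m\<close> of \<open>\<nat>\<^sub>0\<close> is uncovered iff \<open>Y\<^sub>j \<le> m - j\<close> for all
  \<open>j \<le> m\<close>, which has probability \<open>\<Prod>k=1..m+1. \<Sum>l<k. \<mu>\<^sub>l\<close>; this is also the event that the exchange
  process is at 0 at time \<open>m\<close>. Once \<open>m\<close> is uncovered, the earlier radii have no influence
  beyond \<open>m\<close>, and the process starts afresh. Hence the number of uncovered vertices is
  geometric: it is at least \<open>j\<close> with probability \<open>r ^ j\<close>, where \<open>r\<close> is the probability that
  there is one at all (\<open>prob_ext_card_ge\<close>).
  
  Computing the expected number both ways, as the series in \<open>d\<close> without its first term and as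
  \<open>\<Sum>j. r ^ (j + 1)\<close>, shows that \<open>d\<close> is equivalent to \<open>r < 1\<close>
  (\<open>renewal_prob_less_1_iff_summable\<close>). If \<open>r = 1\<close>, there are almost surely infinitely many
  uncovered vertices; if \<open>r < 1\<close>, the number has exponential moments. This settles dimension one.
  
  For the chain, \<open>r\<close> is the return probability to 0, so transience of 0 gives \<open>d\<close>. Conversely, a
  return to a state \<open>x\<close> forces the radii \<open>Y - x\<close>, cut off at 0, to leave a later vertex uncovered. The
  law of \<open>Y - x\<close> satisfies \<open>d\<close> again (\<open>summable_truncated_law\<close>), so this has probability less than
  1, independently of the past (\<open>transient_state_if_summable\<close>).
  
  In dimension \<open>n\<close> the first axis carries a copy of the half-line model, because no path enters it from
  outside; so almost surely finitely many uncovered vertices in some dimension gives \<open>d\<close>. In the other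
  direction, a vertex \<open>y\<close> is uncovered only if no point on the axis-parallel lines leading to it
  covers it. The probability of that is a product over \<open>i\<close> of constant multiples of the terms
  \<open>\<Prod>k=1..y\<^sub>i+1. \<Sum>l<k. \<mu>\<^sub>l\<close>, so its sum over \<open>y\<close> is finite under \<open>d\<close>
  (\<open>expected_uncovered_finite\<close>).
\<close>

section \<open>Independent families with a common law\<close>

lemma iid_with_lawD:
  assumes "iid_with_law M \<mu> I Y"
  shows "prob_space M" "prob_space.indep_vars M (\<lambda>_. count_space UNIV) Y I"
    "\<And>i. i \<in> I \<Longrightarrow> Y i \<in> measurable M (count_space UNIV)"
    "\<And>i. i \<in> I \<Longrightarrow> distr M (count_space UNIV) (Y i) = measure_pmf \<mu>"
proof -
  show M: "prob_space M" and ind: "prob_space.indep_vars M (\<lambda>_. count_space UNIV) Y I"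
    using assms by (auto simp: iid_with_law_def)
  interpret prob_space M by fact
  show Ym: "Y i \<in> measurable M (count_space UNIV)" if "i \<in> I" for i
    using ind that by (auto simp: indep_vars_def)
  show "distr M (count_space UNIV) (Y i) = measure_pmf \<mu>" if "i \<in> I" for i
  proof (rule measure_eqI_countable[where A = UNIV])
    fix k
    have "emeasure (distr M (count_space UNIV) (Y i)) {k} = emeasure M {\<omega> \<in> space M. Y i \<omega> = k}"
      using Ym[OF that] by (subst emeasure_distr) (auto intro!: arg_cong[where f = "emeasure M"])
    also have "\<dots> = ennreal (pmf \<mu> k)"
      using assms that by (simp add: emeasure_eq_measure iid_with_law_def)
    finally show "emeasure (distr M (count_space UNIV) (Y i)) {k} = emeasure (measure_pmf \<mu>) {k}"
      by (simp add: emeasure_pmf_single)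
  qed auto
qed

lemma iid_prob_all_le:
  assumes iid: "iid_with_law M \<mu> I Y" and J: "J \<subseteq> I" "finite J"
  shows "\<P>(\<omega> in M. \<forall>i\<in>J. Y i \<omega> \<le> c i) = (\<Prod>i\<in>J. \<Sum>l\<le>c i. pmf \<mu> l)"
proof (cases "J = {}")
  case True
  then show ?thesis
    using prob_space.prob_space[OF iid_with_lawD(1)[OF iid]] by simp
next
  case False
  interpret prob_space M by (rule iid_with_lawD[OF iid])
  have ind: "indep_vars (\<lambda>_. count_space UNIV) Y J"
    using indep_vars_subset[OF iid_with_lawD(2)[OF iid] J(1)] .
  have one: "prob (Y i -` {..c i} \<inter> space M) = (\<Sum>l\<le>c i. pmf \<mu> l)" if "i \<in> J" for i
  proof -
    have "prob (Y i -` {..c i} \<inter> space M) = measure (distr M (count_space UNIV) (Y i)) {..c i}"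
      using iid_with_lawD(3)[OF iid] that J by (subst measure_distr) auto
    also have "\<dots> = (\<Sum>l\<le>c i. pmf \<mu> l)"
      using iid_with_lawD(4)[OF iid] that J by (simp add: subset_iff measure_measure_pmf_finite)
    finally show ?thesis .
  qed
  have "\<P>(\<omega> in M. \<forall>i\<in>J. Y i \<omega> \<le> c i) = prob (\<Inter>i\<in>J. Y i -` {..c i} \<inter> space M)"
    using False by (intro arg_cong[where f = prob]) auto
  also have "\<dots> = (\<Prod>i\<in>J. prob (Y i -` {..c i} \<inter> space M))"
    by (rule indep_varsD_finite[OF ind False J(2)]) simp
  finally show ?thesis
    using one by simp
qed

lemma iid_reindex:
  assumes iid: "iid_with_law M \<mu> I Y" and f: "inj_on f J" "f ` J \<subseteq> I"
  shows "iid_with_law M \<mu> J (\<lambda>j. Y (f j))"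
proof -
  interpret prob_space M by (rule iid_with_lawD[OF iid])
  let ?F = "\<lambda>i. {Y i -` A \<inter> space M | A. A \<in> sets (count_space UNIV)}"
  have ind: "indep_sets ?F (f ` J)"
    using indep_vars_subset[OF iid_with_lawD(2)[OF iid] f(2)] by (simp add: indep_vars_def2)
  have "indep_sets (\<lambda>j. ?F (f j)) J"
  proof (rule indep_setsI)
    show "?F (f j) \<subseteq> events" if "j \<in> J" for j
      using ind that by (auto simp: indep_sets_def)
    fix A K
    assume K: "K \<noteq> {}" "K \<subseteq> J" "finite K" and A: "\<forall>j\<in>K. A j \<in> ?F (f j)"
    have inj: "inj_on f K"
      using f(1) K(2) by (rule inj_on_subset)
    have inv: "the_inv_into K f (f j) = j" if "j \<in> K" for j
      using inj that by (rule the_inv_into_f_f)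
    have "prob (\<Inter>i\<in>f ` K. A (the_inv_into K f i)) = (\<Prod>i\<in>f ` K. prob (A (the_inv_into K f i)))"
      using K A inv by (intro indep_setsD[OF ind]) auto
    then show "prob (\<Inter>j\<in>K. A j) = (\<Prod>j\<in>K. prob (A j))"
      using inv by (simp add: prod.reindex[OF inj])
  qed
  then have "indep_vars (\<lambda>_. count_space UNIV) (\<lambda>j. Y (f j)) J"
    using f(2) iid_with_lawD(3)[OF iid] by (auto simp: indep_vars_def2)
  then show ?thesis
    using iid f by (auto simp: iid_with_law_def)
qed

lemma iid_map:
  assumes iid: "iid_with_law M \<mu> I Y"
  shows "iid_with_law M (map_pmf f \<mu>) I (\<lambda>i \<omega>. f (Y i \<omega>))"
proof -
  interpret prob_space M by (rule iid_with_lawD[OF iid])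
  have "indep_vars (\<lambda>_. count_space UNIV) (\<lambda>i. f \<circ> Y i) I"
    by (rule indep_vars_compose[OF iid_with_lawD(2)[OF iid]]) simp
  moreover have "\<P>(\<omega> in M. f (Y i \<omega>) = k) = pmf (map_pmf f \<mu>) k" if "i \<in> I" for i k
  proof -
    have "\<P>(\<omega> in M. f (Y i \<omega>) = k) = measure (distr M (count_space UNIV) (Y i)) (f -` {k})"
      using iid_with_lawD(3)[OF iid that]
      by (subst measure_distr) (auto intro!: arg_cong[where f = prob])
    then show ?thesis
      using iid_with_lawD(4)[OF iid that] by (simp add: pmf_map)
  qed
  ultimately show ?thesis
    using iid by (auto simp: iid_with_law_def comp_def)
qed

text \<open>
  This identifies the joint law of the sequence with the product measure, for which splicing a past
  with an independent copy of the sequence is available as the map \<^const>\<open>comb_seq\<close>.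
\<close>

lemma iid_law_PiM:
  assumes iid: "iid_with_law M \<mu> (UNIV :: nat set) Z"
  shows "distr M (PiM UNIV (\<lambda>_. measure_pmf \<mu>)) (\<lambda>\<omega> i. Z i \<omega>) = PiM UNIV (\<lambda>_. measure_pmf \<mu>)"
proof -
  interpret prob_space M by (rule iid_with_lawD[OF iid])
  have "distr M (PiM UNIV (\<lambda>_. count_space UNIV)) (\<lambda>\<omega>. \<lambda>i\<in>UNIV. Z i \<omega>) =
      PiM UNIV (\<lambda>i. distr M (count_space UNIV) (Z i))"
    using indep_vars_iff_distr_eq_PiM[of UNIV Z "\<lambda>_. count_space UNIV"] iid_with_lawD[OF iid] by auto
  moreover have "sets (PiM UNIV (\<lambda>_. measure_pmf \<mu>)) = sets (PiM UNIV (\<lambda>_. count_space UNIV))"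
    by (rule sets_PiM_cong) auto
  ultimately show ?thesis
    using iid_with_lawD(4)[OF iid]
      distr_cong[OF refl, of "PiM UNIV (\<lambda>_. measure_pmf \<mu>)" "PiM UNIV (\<lambda>_. count_space UNIV)" M
        "\<lambda>\<omega> i. Z i \<omega>" "\<lambda>\<omega> i. Z i \<omega>"]
    by (simp add: restrict_def)
qed

text \<open>
  The regeneration property of an i.i.d. sequence: the sequence shifted past time \<open>m\<close> is independent
  of the first \<open>m + 1\<close> entries and has the law of the whole sequence. On the product measure
  this holds because the splicing map preserves the measure.
\<close>

lemma past_future_independent:
  assumes iid: "iid_with_law M \<mu> UNIV Z"
    and meas_P: "Measurable.pred (PiM UNIV (\<lambda>_. count_space UNIV)) P"
    and meas_Q: "Measurable.pred (PiM UNIV (\<lambda>_. count_space UNIV)) Q"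
    and past: "\<And>z z'. (\<And>j. j \<le> m \<Longrightarrow> z j = z' j) \<Longrightarrow> P z = P z'"
  shows "\<P>(\<omega> in M. P (\<lambda>i. Z i \<omega>) \<and> Q (\<lambda>i. Z (Suc m + i) \<omega>)) =
    \<P>(\<omega> in M. P (\<lambda>i. Z i \<omega>)) * \<P>(\<omega> in M. Q (\<lambda>i. Z i \<omega>))"
proof -
  define S where "S = PiM (UNIV :: nat set) (\<lambda>_. measure_pmf \<mu>)"
  have S_sets [measurable_cong]: "sets S = sets (PiM UNIV (\<lambda>_. count_space UNIV))"
    unfolding S_def by (rule sets_PiM_cong) auto
  have S_space: "space S = UNIV"
    by (simp add: S_def space_PiM)
  interpret SS: sequence_space "measure_pmf \<mu>"
    by unfold_locales
  interpret PS: prob_space S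
    unfolding S_def by (rule prob_space_PiM) (rule prob_space_measure_pmf)
  have PS: "Measurable.pred S P" and QS: "Measurable.pred S Q"
    using meas_P meas_Q by (simp_all add: measurable_cong_sets[OF S_sets refl])
  have law: "distr M S (\<lambda>\<omega> i. Z i \<omega>) = S"
    unfolding S_def by (rule iid_law_PiM[OF iid])
  have Zm [measurable]: "(\<lambda>\<omega> i. Z i \<omega>) \<in> measurable M S"
    unfolding measurable_cong_sets[OF refl S_sets]
    using iid_with_lawD(3)[OF iid] by (intro measurable_PiM_single') (auto simp: space_PiM)
  have transfer: "\<P>(\<omega> in M. R (\<lambda>i. Z i \<omega>)) = measure S {z. R z}"
    if [measurable]: "Measurable.pred S R" for R
  proof -
    have "measure S {z. R z} = measure (distr M S (\<lambda>\<omega> i. Z i \<omega>)) {z. R z}"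
      by (simp add: law)
    also have "\<dots> = \<P>(\<omega> in M. R (\<lambda>i. Z i \<omega>))"
      using that S_space
      by (subst measure_distr) (auto simp: pred_def intro!: arg_cong[where f = "measure M"])
    finally show ?thesis ..
  qed
  have shift [measurable]: "(\<lambda>z i. z (Suc m + i)) \<in> measurable S S"
    unfolding measurable_cong_sets[OF S_sets S_sets]
    by (intro measurable_PiM_single') (auto simp: space_PiM)
  have R: "Measurable.pred S (\<lambda>z. P z \<and> Q (\<lambda>i. z (Suc m + i)))"
    using PS measurable_compose[OF shift QS] by (rule pred_intros_logic)
  have comb: "distr (S \<Otimes>\<^sub>M S) S (\<lambda>(z, z'). comb_seq (Suc m) z z') = S"
    unfolding S_def by (rule SS.PiM_comb_seq)
  have combm: "(\<lambda>(z, z'). comb_seq (Suc m) z z') \<in> measurable (S \<Otimes>\<^sub>M S) S"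
    unfolding S_def by (rule measurable_comb_seq)
  have split: "P (comb_seq (Suc m) z z') \<longleftrightarrow> P z"
    "(\<lambda>i. comb_seq (Suc m) z z' (Suc (m + i))) = z'" for z z'
    by (auto intro!: past simp: comb_seq_def)
  have sP: "{z. P z} \<in> sets S" and sQ: "{z. Q z} \<in> sets S"
    using PS QS S_space by (auto simp: pred_def S_sets space_PiM)
  have "emeasure S {z. P z \<and> Q (\<lambda>i. z (Suc m + i))}
      = emeasure (distr (S \<Otimes>\<^sub>M S) S (\<lambda>(z, z'). comb_seq (Suc m) z z')) {z. P z \<and> Q (\<lambda>i. z (Suc m + i))}"
    by (simp add: comb)
  also have "\<dots> = emeasure (S \<Otimes>\<^sub>M S) ({z. P z} \<times> {z. Q z})"
    using R S_space
    by (subst emeasure_distr[OF combm])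
      (auto simp: pred_def split space_pair_measure intro!: arg_cong[where f = "emeasure (S \<Otimes>\<^sub>M S)"])
  also have "\<dots> = emeasure S {z. P z} * emeasure S {z. Q z}"
    by (rule PS.emeasure_pair_measure_Times[OF sP sQ])
  finally have "measure S {z. P z \<and> Q (\<lambda>i. z (Suc m + i))} = measure S {z. P z} * measure S {z. Q z}"
    by (simp add: measure_def enn2real_mult)
  then show ?thesis
    using transfer[OF R] transfer[OF PS] transfer[OF QS] by simp
qed

section \<open>Cardinality of random sets\<close>

lemma enat_le_ext_card_iff: "enat j \<le> ext_card A \<longleftrightarrow> (\<exists>B\<subseteq>A. finite B \<and> card B = j)"
proof (cases "finite A")
  case True
  then show ?thesis
    by (auto simp: ext_card_def intro: card_mono dest: obtain_subset_with_card_n)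
next
  case False
  then show ?thesis
    using infinite_arbitrarily_large[of A j] by (auto simp: ext_card_def)
qed

text \<open>
  The event that a random set has at least \<open>j\<close> elements is a countable union, over the
  duplicate-free lists of length \<open>j\<close>, of finite intersections of membership events.
\<close>

lemma measurable_ext_card:
  fixes A :: "'a \<Rightarrow> 'v::countable set"
  assumes [measurable]: "\<And>y. Measurable.pred M (\<lambda>\<omega>. y \<in> A \<omega>)"
  shows "(\<lambda>\<omega>. ext_card (A \<omega>)) \<in> measurable M (count_space UNIV)"
proof -
  have "enat j \<le> ext_card (A \<omega>) \<longleftrightarrow> (\<exists>ys. (distinct ys \<and> length ys = j) \<and> (\<forall>y\<in>set ys. y \<in> A \<omega>))"
    for j \<omega>
  proof
    assume "enat j \<le> ext_card (A \<omega>)"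
    then obtain B where "B \<subseteq> A \<omega>" "finite B" "card B = j"
      by (auto simp: enat_le_ext_card_iff)
    moreover obtain ys where "set ys = B" "distinct ys"
      using finite_distinct_list[OF \<open>finite B\<close>] by blast
    ultimately show "\<exists>ys. (distinct ys \<and> length ys = j) \<and> (\<forall>y\<in>set ys. y \<in> A \<omega>)"
      using distinct_card by fastforce
  next
    assume "\<exists>ys. (distinct ys \<and> length ys = j) \<and> (\<forall>y\<in>set ys. y \<in> A \<omega>)"
    then obtain ys where "distinct ys" "length ys = j" "set ys \<subseteq> A \<omega>"
      by auto
    then show "enat j \<le> ext_card (A \<omega>)"
      unfolding enat_le_ext_card_iff by (intro exI[of _ "set ys"]) (simp add: distinct_card)
  qed
  moreover have "Measurable.pred M (\<lambda>\<omega>. \<exists>ys. (distinct ys \<and> length ys = j) \<and> (\<forall>y\<in>set ys. y \<in> A \<omega>))" for j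
    by measurable
  ultimately have ge [measurable]: "Measurable.pred M (\<lambda>\<omega>. enat j \<le> ext_card (A \<omega>))" for j
    by (simp only:)
  have fin: "c = enat n \<longleftrightarrow> enat n \<le> c \<and> \<not> enat (Suc n) \<le> c" for c n
    by (cases c) auto
  have inf: "c = \<infinity> \<longleftrightarrow> (\<forall>n. enat n \<le> c)" for c
  proof (cases c)
    case (enat k)
    then have "\<not> enat (Suc k) \<le> c"
      by simp
    then show ?thesis
      using enat by blast
  qed simp
  have "Measurable.pred M (\<lambda>\<omega>. ext_card (A \<omega>) = c)" for c
  proof (cases c)
    case (enat n)
    show ?thesis
      unfolding enat fin[of _ n] by measurable
  next
    case infinity
    show ?thesis
      unfolding infinity inf by measurable
  qed
  then have "{\<omega> \<in> space M. ext_card (A \<omega>) = c} \<in> sets M" for c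
    by (simp add: pred_def)
  moreover have "(\<lambda>\<omega>. ext_card (A \<omega>)) -` {c} \<inter> space M = {\<omega> \<in> space M. ext_card (A \<omega>) = c}" for c
    by auto
  ultimately show ?thesis
    by (simp add: measurable_count_space_eq2_countable)
qed

lemma ennreal_of_enat_ext_card:
  "ennreal_of_enat (ext_card A) = (\<integral>\<^sup>+y. indicator A y \<partial>count_space UNIV)"
  by (simp add: ext_card_def emeasure_count_space)

lemma nn_integral_ext_card:
  fixes A :: "'a \<Rightarrow> 'v::countable set"
  assumes [measurable]: "\<And>y. Measurable.pred M (\<lambda>\<omega>. y \<in> A \<omega>)"
  shows "(\<integral>\<^sup>+\<omega>. ennreal_of_enat (ext_card (A \<omega>)) \<partial>M) =
    (\<integral>\<^sup>+y. emeasure M {\<omega>\<in>space M. y \<in> A \<omega>} \<partial>count_space UNIV)"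
proof -
  have "(\<integral>\<^sup>+\<omega>. ennreal_of_enat (ext_card (A \<omega>)) \<partial>M) =
      (\<integral>\<^sup>+\<omega>. \<integral>\<^sup>+y. indicator {\<omega>\<in>space M. y \<in> A \<omega>} \<omega> \<partial>count_space UNIV \<partial>M)"
    unfolding ennreal_of_enat_ext_card
    by (intro nn_integral_cong) (auto split: split_indicator)
  also have "\<dots> = (\<integral>\<^sup>+y. \<integral>\<^sup>+\<omega>. indicator {\<omega>\<in>space M. y \<in> A \<omega>} \<omega> \<partial>M \<partial>count_space UNIV)"
    by (rule nn_integral_count_space_nn_integral) auto
  finally show ?thesis
    by simp
qed

lemma AE_ext_card_finite:
  fixes A :: "'a \<Rightarrow> 'v::countable set"
  assumes A: "\<And>y. Measurable.pred M (\<lambda>\<omega>. y \<in> A \<omega>)"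
    and fin: "(\<integral>\<^sup>+\<omega>. ennreal_of_enat (ext_card (A \<omega>)) \<partial>M) < \<infinity>"
  shows "AE \<omega> in M. ext_card (A \<omega>) < \<infinity>"
proof -
  have "(\<lambda>\<omega>. ennreal_of_enat (ext_card (A \<omega>))) \<in> borel_measurable M"
    by (rule measurable_compose[OF measurable_ext_card[OF A]]) simp
  then have "AE \<omega> in M. ennreal_of_enat (ext_card (A \<omega>)) \<noteq> \<infinity>"
    using fin by (intro nn_integral_PInf_AE) auto
  then show ?thesis
  proof eventually_elim
    case (elim \<omega>)
    then show ?case
      by (cases "ext_card (A \<omega>)") auto
  qed
qed

section \<open>Uncovered vertices of the half-line\<close>

text \<open>
  The vertices of the half-line that remain uncovered when vertex \<open>j\<close> has radius \<open>z j\<close>; by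
  \<open>exchange_process_eq_0_iff\<close> below they are also the times at which the random exchange process
  driven by \<open>z\<close> vanishes.
\<close>

definition renewal_set :: "(nat \<Rightarrow> nat) \<Rightarrow> nat set" where
  "renewal_set z = {m. \<forall>j\<le>m. z j \<le> m - j}"

lemma pred_renewal_set [measurable]:
  "Measurable.pred (PiM UNIV (\<lambda>_. count_space UNIV)) (\<lambda>z. m \<in> renewal_set z)"
  unfolding renewal_set_def mem_Collect_eq by measurable

lemma pred_ext_card_renewal_set [measurable]:
  "Measurable.pred (PiM UNIV (\<lambda>_. count_space UNIV)) (\<lambda>z. c \<le> ext_card (renewal_set z))"
  by (rule measurable_compose[OF measurable_ext_card]) simp_all

lemma renewal_set_cong:
  assumes "\<And>j. j \<le> m \<Longrightarrow> z j = z' j" and "k \<le> m"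
  shows "k \<in> renewal_set z \<longleftrightarrow> k \<in> renewal_set z'"
  using assms by (simp add: renewal_set_def)

text \<open>
  An uncovered vertex screens off everything before it: a ball that does not reach \<open>m\<close> reaches
  nothing beyond \<open>m\<close> either. What happens after \<open>m\<close> is therefore decided by the later radii alone,
  and it is the same model again.
\<close>

lemma renewal_set_after:
  assumes m: "m \<in> renewal_set z"
  shows "Suc m + k \<in> renewal_set z \<longleftrightarrow> k \<in> renewal_set (\<lambda>i. z (Suc m + i))"
proof
  assume "Suc m + k \<in> renewal_set z"
  then show "k \<in> renewal_set (\<lambda>i. z (Suc m + i))"
    by (fastforce simp: renewal_set_def dest: spec[of _ "Suc m + _"])
next
  assume k: "k \<in> renewal_set (\<lambda>i. z (Suc m + i))"
  have "z j \<le> Suc m + k - j" if "j \<le> Suc m + k" for j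
  proof (cases "j \<le> m")
    case True
    then have "z j \<le> m - j"
      using m by (simp add: renewal_set_def)
    then show ?thesis
      by simp
  next
    case False
    then obtain i where "j = Suc m + i"
      by (metis not_less_eq_eq le_add_diff_inverse)
    then show ?thesis
      using k that by (simp add: renewal_set_def)
  qed
  then show "Suc m + k \<in> renewal_set z"
    by (simp add: renewal_set_def)
qed

definition first_renewal :: "nat \<Rightarrow> (nat \<Rightarrow> nat) \<Rightarrow> bool" where
  "first_renewal m z \<longleftrightarrow> m \<in> renewal_set z \<and> (\<forall>k<m. k \<notin> renewal_set z)"

lemma pred_first_renewal [measurable]:
  "Measurable.pred (PiM UNIV (\<lambda>_. count_space UNIV)) (first_renewal m)"
  unfolding first_renewal_def by measurable

lemma first_renewal_ex1: "renewal_set z \<noteq> {} \<longleftrightarrow> (\<exists>!m. first_renewal m z)"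
proof
  assume "renewal_set z \<noteq> {}"
  then have ex: "\<exists>m. m \<in> renewal_set z"
    by auto
  have unique: "m = m'" if "first_renewal m z" "first_renewal m' z" for m m'
    using that unfolding first_renewal_def by (cases m m' rule: linorder_cases) blast+
  have "first_renewal (LEAST m. m \<in> renewal_set z) z"
    unfolding first_renewal_def using LeastI_ex[OF ex] not_less_Least by blast
  then show "\<exists>!m. first_renewal m z"
    using unique by blast
qed (auto simp: first_renewal_def)

text \<open>
  Past the first uncovered vertex the picture starts afresh, so one point is removed from the count.
\<close>

lemma first_renewal_card:
  assumes "first_renewal m z"
  shows "enat (Suc j) \<le> ext_card (renewal_set z) \<longleftrightarrow>
    enat j \<le> ext_card (renewal_set (\<lambda>i. z (Suc m + i)))"
proof -
  let ?R = "renewal_set (\<lambda>i. z (Suc m + i))"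
  have m: "m \<in> renewal_set z" and first: "\<forall>k<m. k \<notin> renewal_set z"
    using assms by (simp_all add: first_renewal_def)
  have "k \<in> renewal_set z \<longleftrightarrow> k \<in> insert m ((+) (Suc m) ` ?R)" for k
  proof (cases k m rule: linorder_cases)
    case greater
    then obtain i where "k = Suc m + i"
      by (metis less_eq_Suc_le le_add_diff_inverse)
    then show ?thesis
      using renewal_set_after[OF m, of i] by auto
  qed (use first m in auto)
  then have eq: "renewal_set z = insert m ((+) (Suc m) ` ?R)"
    by blast
  have "m \<notin> (+) (Suc m) ` ?R"
    by auto
  moreover have "inj_on ((+) (Suc m)) ?R"
    by simp
  ultimately show ?thesis
    unfolding eq ext_card_def
    by (simp add: finite_image_iff card_image del: add_Suc plus_nat.add_Suc)
qed

lemma prod_reversed: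
  fixes f :: "nat \<Rightarrow> 'a::comm_semiring_1"
  shows "(\<Prod>j\<in>{..m}. \<Sum>l\<le>m - j. f l) = (\<Prod>k=1..Suc m. \<Sum>l<k. f l)"
  by (rule prod.reindex_bij_witness[where i = "\<lambda>k. Suc m - k" and j = "\<lambda>j. Suc (m - j)"])
    (auto simp: lessThan_Suc_atMost)

text \<open>
  This is where the products in condition \<open>d\<close> come from: from index 1 on, they are the
  probabilities that a given vertex of the half-line is uncovered.
\<close>

lemma prob_renewal_mem:
  assumes iid: "iid_with_law M \<mu> UNIV Z"
  shows "\<P>(\<omega> in M. m \<in> renewal_set (\<lambda>i. Z i \<omega>)) = (\<Prod>k=1..Suc m. \<Sum>l<k. pmf \<mu> l)"
proof -
  have "\<P>(\<omega> in M. m \<in> renewal_set (\<lambda>i. Z i \<omega>)) = \<P>(\<omega> in M. \<forall>j\<in>{..m}. Z j \<omega> \<le> m - j)"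
    by (simp add: renewal_set_def Ball_def)
  also have "\<dots> = (\<Prod>j\<in>{..m}. \<Sum>l\<le>m - j. pmf \<mu> l)"
    by (rule iid_prob_all_le[OF iid]) auto
  also have "\<dots> = (\<Prod>k=1..Suc m. \<Sum>l<k. pmf \<mu> l)"
    by (rule prod_reversed)
  finally show ?thesis .
qed

lemma measurable_sequence:
  assumes iid: "iid_with_law M \<mu> UNIV Z"
  shows "(\<lambda>\<omega> i. Z i \<omega>) \<in> measurable M (PiM (UNIV :: nat set) (\<lambda>_. count_space UNIV))"
  using iid_with_lawD(3)[OF iid] by (intro measurable_PiM_single') (auto simp: space_PiM)

lemma pred_mem_renewal_set:
  assumes iid: "iid_with_law M \<mu> UNIV Z"
  shows "Measurable.pred M (\<lambda>\<omega>. m \<in> renewal_set (\<lambda>i. Z i \<omega>))"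
  by (rule measurable_compose[OF measurable_sequence[OF iid] pred_renewal_set])

text \<open>
  The number of uncovered vertices is geometric. By regeneration at the first of them, having
  at least \<open>j + 1\<close> means having a first one, and then at least \<open>j\<close> in an independent copy.
\<close>

lemma prob_ext_card_ge:
  assumes iid: "iid_with_law M \<mu> UNIV Z"
  shows "\<P>(\<omega> in M. enat j \<le> ext_card (renewal_set (\<lambda>i. Z i \<omega>))) =
    \<P>(\<omega> in M. renewal_set (\<lambda>i. Z i \<omega>) \<noteq> {}) ^ j"
proof (induction j)
  case 0
  then show ?case
    using prob_space.prob_space[OF iid_with_lawD(1)[OF iid]] by (simp add: zero_enat_def[symmetric])
next
  case (Suc j)
  interpret prob_space M by (rule iid_with_lawD[OF iid])
  note seq = measurable_sequence[OF iid]
  note [measurable] = measurable_compose[OF seq pred_first_renewal]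
    measurable_compose[OF seq pred_renewal_set] measurable_compose[OF seq pred_ext_card_renewal_set]
  let ?R = "\<lambda>\<omega>. renewal_set (\<lambda>i. Z i \<omega>)"
  let ?r = "\<P>(\<omega> in M. ?R \<omega> \<noteq> {})"
  have first_sums: "(\<lambda>m. \<P>(\<omega> in M. first_renewal m (\<lambda>i. Z i \<omega>))) sums ?r"
  proof (rule prob_sums)
    have "{\<omega> \<in> space M. ?R \<omega> \<noteq> {}} = {\<omega> \<in> space M. \<exists>m. m \<in> ?R \<omega>}"
      by auto
    also have "\<dots> \<in> events"
      by measurable
    finally show "{\<omega> \<in> space M. ?R \<omega> \<noteq> {}} \<in> events" .
    show "AE \<omega> in M. (\<forall>m. first_renewal m (\<lambda>i. Z i \<omega>) \<longrightarrow> ?R \<omega> \<noteq> {}) \<and>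
        (?R \<omega> \<noteq> {} \<longrightarrow> (\<exists>!m. first_renewal m (\<lambda>i. Z i \<omega>)))"
    proof (intro AE_I2 conjI allI impI)
      show "?R \<omega> \<noteq> {}" if "first_renewal m (\<lambda>i. Z i \<omega>)" for m \<omega>
        using that by (auto simp: first_renewal_def)
      show "\<exists>!m. first_renewal m (\<lambda>i. Z i \<omega>)" if "?R \<omega> \<noteq> {}" for \<omega>
        using that by (simp only: first_renewal_ex1)
    qed
  qed measurable
  have "(\<lambda>m. \<P>(\<omega> in M. first_renewal m (\<lambda>i. Z i \<omega>) \<and> enat (Suc j) \<le> ext_card (?R \<omega>)))
      sums \<P>(\<omega> in M. enat (Suc j) \<le> ext_card (?R \<omega>))"
  proof (rule prob_sums)
    have "?R \<omega> \<noteq> {}" if "enat (Suc j) \<le> ext_card (?R \<omega>)" for \<omega>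
      using that by (auto simp: ext_card_def)
    then show "AE \<omega> in M. (\<forall>m. first_renewal m (\<lambda>i. Z i \<omega>) \<and> enat (Suc j) \<le> ext_card (?R \<omega>) \<longrightarrow>
          enat (Suc j) \<le> ext_card (?R \<omega>)) \<and>
        (enat (Suc j) \<le> ext_card (?R \<omega>) \<longrightarrow>
          (\<exists>!m. first_renewal m (\<lambda>i. Z i \<omega>) \<and> enat (Suc j) \<le> ext_card (?R \<omega>)))"
      using first_renewal_ex1 by simp
  qed measurable
  moreover have "\<P>(\<omega> in M. first_renewal m (\<lambda>i. Z i \<omega>) \<and> enat (Suc j) \<le> ext_card (?R \<omega>)) =
      \<P>(\<omega> in M. first_renewal m (\<lambda>i. Z i \<omega>)) * ?r ^ j" for m
  proof -
    have "\<P>(\<omega> in M. first_renewal m (\<lambda>i. Z i \<omega>) \<and> enat (Suc j) \<le> ext_card (?R \<omega>)) =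
        \<P>(\<omega> in M. first_renewal m (\<lambda>i. Z i \<omega>) \<and>
          enat j \<le> ext_card (renewal_set (\<lambda>i. Z (Suc m + i) \<omega>)))"
      using first_renewal_card[of m _ j] by (intro arg_cong[where f = prob]) auto
    also have "\<dots> = \<P>(\<omega> in M. first_renewal m (\<lambda>i. Z i \<omega>)) * \<P>(\<omega> in M. enat j \<le> ext_card (?R \<omega>))"
    proof (rule past_future_independent[OF iid pred_first_renewal pred_ext_card_renewal_set])
      show "first_renewal m z = first_renewal m z'" if "\<And>j. j \<le> m \<Longrightarrow> z j = z' j" for z z'
        using renewal_set_cong[OF that] by (simp add: first_renewal_def)
    qed
    finally show ?thesis
      by (simp add: Suc.IH)
  qed
  ultimately have "(\<lambda>m. \<P>(\<omega> in M. first_renewal m (\<lambda>i. Z i \<omega>)) * ?r ^ j)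
      sums \<P>(\<omega> in M. enat (Suc j) \<le> ext_card (?R \<omega>))"
    by simp
  with sums_mult2[OF first_sums, of "?r ^ j"] show ?case
    by (simp add: sums_iff)
qed

section \<open>Convergence of the series and finiteness on the half-line\<close>

lemma nn_integral_renewals_geometric:
  assumes iid: "iid_with_law M \<mu> UNIV Z"
  shows "(\<integral>\<^sup>+\<omega>. ennreal_of_enat (ext_card (renewal_set (\<lambda>i. Z i \<omega>))) \<partial>M) =
    (\<Sum>j. ennreal (\<P>(\<omega> in M. renewal_set (\<lambda>i. Z i \<omega>) \<noteq> {}) ^ Suc j))"
proof -
  interpret prob_space M by (rule iid_with_lawD[OF iid])
  have "emeasure M {\<omega> \<in> space M. enat j < ext_card (renewal_set (\<lambda>i. Z i \<omega>))} =
      ennreal (\<P>(\<omega> in M. renewal_set (\<lambda>i. Z i \<omega>) \<noteq> {}) ^ Suc j)" for j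
    using prob_ext_card_ge[OF iid, of "Suc j"] by (simp add: emeasure_eq_measure Suc_ile_eq)
  then show ?thesis
    by (subst nn_integral_enat_function[OF measurable_ext_card[OF pred_mem_renewal_set[OF iid]]]) simp
qed

lemma nn_integral_renewals_series:
  assumes iid: "iid_with_law M \<mu> UNIV Z"
  shows "(\<integral>\<^sup>+\<omega>. ennreal_of_enat (ext_card (renewal_set (\<lambda>i. Z i \<omega>))) \<partial>M) =
    (\<Sum>m. ennreal (\<Prod>k=1..Suc m. \<Sum>l<k. pmf \<mu> l))"
proof -
  interpret prob_space M by (rule iid_with_lawD[OF iid])
  show ?thesis
    unfolding nn_integral_ext_card[OF pred_mem_renewal_set[OF iid]] nn_integral_count_space_nat
      emeasure_eq_measure prob_renewal_mem[OF iid] ..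
qed

text \<open>
  The expected number of uncovered vertices of the half-line is computed in two ways: as the series
  of the probabilities of the single vertices, and as a geometric series, because the
  count is geometric. The two series have the same value in \<open>[0, \<infinity>]\<close>, hence converge together.
\<close>

lemma renewal_prob_less_1_iff_summable:
  assumes iid: "iid_with_law M \<mu> UNIV Z"
  shows "\<P>(\<omega> in M. renewal_set (\<lambda>i. Z i \<omega>) \<noteq> {}) < 1 \<longleftrightarrow>
    summable (\<lambda>m. \<Prod>k=1..m. \<Sum>l<k. pmf \<mu> l)" (is "?r < 1 \<longleftrightarrow> summable ?q")
proof -
  let ?E = "\<integral>\<^sup>+\<omega>. ennreal_of_enat (ext_card (renewal_set (\<lambda>i. Z i \<omega>))) \<partial>M"
  have q0: "0 \<le> ?q m" for m
    by (intro prod_nonneg sum_nonneg) auto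
  have finite_iff: "(\<Sum>i. ennreal (f i)) \<noteq> \<top> \<longleftrightarrow> summable f" if "\<And>i. 0 \<le> f i" for f
    using that by (auto simp: suminf_ennreal2 intro: summable_suminf_not_top)
  have r0: "0 \<le> ?r"
    by simp
  have "?E \<noteq> \<top> \<longleftrightarrow> summable (\<lambda>j. ?r ^ Suc j)"
    unfolding nn_integral_renewals_geometric[OF iid] by (rule finite_iff) simp
  also have "\<dots> \<longleftrightarrow> ?r < 1"
    unfolding summable_Suc_iff summable_geometric_iff using r0 by (simp only: real_norm_def abs_of_nonneg)
  finally have "?E \<noteq> \<top> \<longleftrightarrow> ?r < 1" .
  moreover have "?E \<noteq> \<top> \<longleftrightarrow> summable (\<lambda>m. ?q (Suc m))"
    unfolding nn_integral_renewals_series[OF iid] by (rule finite_iff) (rule q0)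
  ultimately show ?thesis
    using summable_Suc_iff[of ?q] by blast
qed

text \<open>
  A geometric count has no middle ground: if a first uncovered vertex exists almost surely,
  then so does a \<open>j\<close>-th one for every \<open>j\<close>; otherwise already the expectation is finite. Almost sure
  finiteness is thus as strong as finite expectation.
\<close>

lemma AE_finite_renewals_iff_summable:
  assumes iid: "iid_with_law M \<mu> UNIV Z"
  shows "(AE \<omega> in M. finite (renewal_set (\<lambda>i. Z i \<omega>))) \<longleftrightarrow>
    summable (\<lambda>m. \<Prod>k=1..m. \<Sum>l<k. pmf \<mu> l)"
proof -
  interpret prob_space M by (rule iid_with_lawD[OF iid])
  let ?R = "\<lambda>\<omega>. renewal_set (\<lambda>i. Z i \<omega>)"
  let ?r = "\<P>(\<omega> in M. ?R \<omega> \<noteq> {})"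
  note [measurable] = pred_mem_renewal_set[OF iid] measurable_compose[OF measurable_sequence[OF iid] pred_ext_card_renewal_set]
  have "?r < 1" if fin: "AE \<omega> in M. finite (?R \<omega>)"
  proof (rule ccontr)
    assume "\<not> ?r < 1"
    then have "?r = 1"
      using prob_le_1 by (simp add: antisym not_less)
    then have "prob {\<omega> \<in> space M. enat j \<le> ext_card (?R \<omega>)} = 1" for j
      using prob_ext_card_ge[OF iid, of j] by simp
    then have ge: "AE \<omega> in M. \<omega> \<in> {\<omega> \<in> space M. enat j \<le> ext_card (?R \<omega>)}" for j
      by (rule AE_prob_1)
    have "AE \<omega> in M. enat j \<le> ext_card (?R \<omega>)" for j
      using ge[of j] by eventually_elim simp
    then have "AE \<omega> in M. \<forall>j. enat j \<le> ext_card (?R \<omega>)"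
      by (simp add: AE_all_countable)
    with fin have "AE \<omega> in M. False"
    proof eventually_elim
      case (elim \<omega>)
      then have "finite (?R \<omega>)" "enat (Suc (card (?R \<omega>))) \<le> ext_card (?R \<omega>)"
        by blast+
      then show ?case
        by (simp add: ext_card_def)
    qed
    then show False
      by simp
  qed
  moreover have "AE \<omega> in M. finite (?R \<omega>)" if sm: "summable (\<lambda>m. \<Prod>k=1..m. \<Sum>l<k. pmf \<mu> l)"
  proof -
    have "summable (\<lambda>m. \<Prod>k=1..Suc m. \<Sum>l<k. pmf \<mu> l)"
      using sm by (subst summable_Suc_iff)
    then have "(\<Sum>m. ennreal (\<Prod>k=1..Suc m. \<Sum>l<k. pmf \<mu> l)) < \<infinity>"
      by (subst suminf_ennreal2) (intro prod_nonneg sum_nonneg ballI pmf_nonneg, auto)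
    then have "(\<integral>\<^sup>+\<omega>. ennreal_of_enat (ext_card (?R \<omega>)) \<partial>M) < \<infinity>"
      unfolding nn_integral_renewals_series[OF iid] .
    then have "AE \<omega> in M. ext_card (?R \<omega>) < \<infinity>"
      by (intro AE_ext_card_finite) measurable
    then show ?thesis
      by eventually_elim (simp add: ext_card_def split: if_splits)
  qed
  ultimately show ?thesis
    using renewal_prob_less_1_iff_summable[OF iid] by blast
qed

text \<open>
  Bounds the exponential by tail indicators, whose expectations are known exactly. The
  value at infinity is covered because the geometric series on the right diverges there.
\<close>

lemma exp_mult_enat_le_series:
  assumes "0 < \<alpha>"
  shows "exp_mult_enat \<alpha> c \<le> (\<Sum>k. ennreal (exp \<alpha> ^ k) * (if enat k \<le> c then 1 else 0))"
proof (cases c)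
  case (enat n)
  have "ennreal (exp \<alpha> ^ n) * (if enat n \<le> c then 1 else 0) \<le>
      (\<Sum>k. ennreal (exp \<alpha> ^ k) * (if enat k \<le> c then 1 else 0))"
    using sum_le_suminf[of "\<lambda>k. ennreal (exp \<alpha> ^ k) * (if enat k \<le> c then 1 else 0)" "{n}"]
    by (simp add: summableI)
  then show ?thesis
    by (simp add: enat exp_mult_enat_def exp_of_nat_mult[symmetric] mult.commute)
next
  case infinity
  have "\<not> summable (\<lambda>k. exp \<alpha> ^ k)"
    using assms by (simp add: summable_geometric_iff)
  moreover have "0 \<le> exp \<alpha> ^ k" for k
    by simp
  ultimately have "(\<Sum>k. ennreal (exp \<alpha> ^ k)) = \<top>"
    using summable_suminf_not_top[of "\<lambda>k. exp \<alpha> ^ k"] by blast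
  then show ?thesis
    by (simp add: infinity)
qed

lemma renewals_exponential_moment:
  assumes iid: "iid_with_law M \<mu> UNIV Z"
    and less: "\<P>(\<omega> in M. renewal_set (\<lambda>i. Z i \<omega>) \<noteq> {}) < 1"
  shows "\<exists>\<alpha>>0. (\<integral>\<^sup>+\<omega>. exp_mult_enat \<alpha> (ext_card (renewal_set (\<lambda>i. Z i \<omega>))) \<partial>M) < \<infinity>"
proof -
  interpret prob_space M by (rule iid_with_lawD[OF iid])
  let ?R = "\<lambda>\<omega>. renewal_set (\<lambda>i. Z i \<omega>)"
  define r where "r = \<P>(\<omega> in M. ?R \<omega> \<noteq> {})"
  note [measurable] = measurable_compose[OF measurable_sequence[OF iid] pred_ext_card_renewal_set]
  have r: "0 \<le> r" "r < 1"
    using less by (auto simp: r_def)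
  \<comment> \<open>any positive \<open>\<alpha>\<close> with \<open>exp \<alpha> < 1 / r\<close> would do; this choice also covers \<open>r = 0\<close>\<close>
  define \<alpha> where "\<alpha> = ln (2 / (1 + r))"
  have \<alpha>: "0 < \<alpha>" "exp \<alpha> * r < 1"
    using r by (auto simp: \<alpha>_def field_simps)
  have "(\<integral>\<^sup>+\<omega>. exp_mult_enat \<alpha> (ext_card (?R \<omega>)) \<partial>M) \<le>
      (\<integral>\<^sup>+\<omega>. (\<Sum>k. ennreal (exp \<alpha> ^ k) * indicator {\<omega>\<in>space M. enat k \<le> ext_card (?R \<omega>)} \<omega>) \<partial>M)"
    using exp_mult_enat_le_series[OF \<alpha>(1)]
    by (intro nn_integral_mono) (simp add: indicator_def of_bool_def)
  also have "\<dots> = (\<Sum>k. ennreal (exp \<alpha> ^ k) * emeasure M {\<omega>\<in>space M. enat k \<le> ext_card (?R \<omega>)})"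
    by (subst nn_integral_suminf) (simp_all add: nn_integral_cmult_indicator)
  also have "\<dots> = (\<Sum>k. ennreal ((exp \<alpha> * r) ^ k))"
    using r(1)
    by (simp add: emeasure_eq_measure prob_ext_card_ge[OF iid] r_def[symmetric] power_mult_distrib ennreal_mult)
  also have "\<dots> < \<infinity>"
    using r \<alpha>(2) by (subst suminf_ennreal2) (auto simp: summable_geometric_iff)
  finally show ?thesis
    using \<alpha>(1) by blast
qed

section \<open>Transience of the random exchange process\<close>

text \<open>
  The exchange process is the maximum of the inputs so far, each lowered by its age. Since the
  level \<open>x\<close> is natural, lowering the input is the same as raising the level.
\<close>

lemma exchange_process_le_iff:
  "exchange_process Z m \<omega> \<le> x \<longleftrightarrow> (\<forall>j\<le>m. Z j \<omega> \<le> (m - j) + x)"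
proof (induction m arbitrary: x)
  case (Suc m)
  have "exchange_process Z (Suc m) \<omega> \<le> x \<longleftrightarrow> exchange_process Z m \<omega> \<le> Suc x \<and> Z (Suc m) \<omega> \<le> x"
    by auto
  also have "\<dots> \<longleftrightarrow> (\<forall>j\<le>m. Z j \<omega> \<le> (m - j) + Suc x) \<and> Z (Suc m) \<omega> \<le> x"
    unfolding Suc.IH ..
  also have "\<dots> \<longleftrightarrow> (\<forall>j\<le>Suc m. Z j \<omega> \<le> (Suc m - j) + x)"
  proof -
    have "m - j + Suc x = Suc m - j + x" if "j \<le> m" for j
      using that by (simp add: Suc_diff_le)
    moreover have "(\<forall>j\<le>Suc m. P j) \<longleftrightarrow> (\<forall>j\<le>m. P j) \<and> P (Suc m)" for P
      by (auto simp: le_Suc_eq)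
    ultimately show ?thesis
      by simp
  qed
  finally show ?case .
qed simp

lemma exchange_process_eq_0_iff:
  "exchange_process Z m \<omega> = 0 \<longleftrightarrow> m \<in> renewal_set (\<lambda>i. Z i \<omega>)"
  using exchange_process_le_iff[of Z m \<omega> 0] by (simp add: renewal_set_def)

text \<open>
  Separates the process into a deterministic function of the input sequence and the random
  sequence, so that events of the process become events of the sequence space.
\<close>

lemma exchange_process_sequence:
  "exchange_process Z m \<omega> = exchange_process (\<lambda>i z. z i) m (\<lambda>i. Z i \<omega>)"
  by (induction m) simp_all

lemma exchange_process_cong:
  assumes "\<And>j. j \<le> m \<Longrightarrow> z j = z' j"
  shows "exchange_process (\<lambda>i z. z i) m z = exchange_process (\<lambda>i z. z i) m z'"
  using assms by (induction m) simp_all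

lemma measurable_exchange_process:
  "exchange_process (\<lambda>i z. z i) m \<in> measurable (PiM UNIV (\<lambda>_. count_space UNIV)) (count_space UNIV)"
proof (induction m)
  case (Suc m)
  note [measurable] = Suc.IH
  have "(\<lambda>z. max (exchange_process (\<lambda>i z. z i) m z - 1) (z (Suc m)))
      \<in> measurable (PiM UNIV (\<lambda>_. count_space UNIV)) (count_space UNIV)"
    by measurable
  then show ?case
    by simp
qed simp

text \<open>
  Lowering all radii by \<open>x\<close> shifts the distribution function by \<open>x\<close>, which cuts off the first \<open>x\<close>
  factors of each product. These factors are positive, so convergence is unaffected.
\<close>

lemma summable_truncated_law:
  assumes pos: "0 < pmf \<mu> 0"
    and sm: "summable (\<lambda>m. \<Prod>k=1..m. \<Sum>l<k. pmf \<mu> l)"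
  shows "summable (\<lambda>m. \<Prod>k=1..m. \<Sum>l<k. pmf (map_pmf (\<lambda>z. z - x) \<mu>) l)"
proof -
  let ?F = "\<lambda>k. \<Sum>l<k. pmf \<mu> l"
  have F: "(\<Sum>l<k. pmf (map_pmf (\<lambda>z. z - x) \<mu>) l) = ?F (k + x)" if "1 \<le> k" for k
  proof -
    have "(\<lambda>z. z - x) -` {..<k} = {..<k + x}"
      using that by auto
    then show ?thesis
      by (simp add: measure_measure_pmf_finite[symmetric])
  qed
  have "(\<Prod>k=1..m + x. ?F k) = (\<Prod>k=1..x. ?F k) * (\<Prod>k=1..m. ?F (k + x))" for m
    by (induction m) simp_all
  moreover have "(\<Prod>k=1..m. ?F (k + x)) = (\<Prod>k=1..m. \<Sum>l<k. pmf (map_pmf (\<lambda>z. z - x) \<mu>) l)" for m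
    using F by (intro prod.cong) auto
  ultimately have "summable (\<lambda>m. (\<Prod>k=1..x. ?F k) * (\<Prod>k=1..m. \<Sum>l<k. pmf (map_pmf (\<lambda>z. z - x) \<mu>) l))"
    using summable_ignore_initial_segment[OF sm, of x] by simp
  moreover have "0 < ?F k" if "1 \<le> k" for k
    using that pos by (intro sum_pos2[of _ 0]) auto
  then have "(\<Prod>k=1..x. ?F k) \<noteq> 0"
    by (auto simp: less_imp_neq[symmetric])
  ultimately show ?thesis
    by (simp only: summable_cmult_iff simp_thms)
qed

text \<open>
  Started in 0, the process returns to 0 exactly when the shifted sequence has an uncovered vertex, so
  the return probability is the success probability of the geometric count.
\<close>

lemma transient_state_0_imp_renewal_prob_less_1:
  assumes iid: "iid_with_law N \<mu> UNIV Z" and pos: "0 < pmf \<mu> 0"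
    and tr: "transient_state N (exchange_process Z) 0"
  shows "\<P>(\<omega> in N. renewal_set (\<lambda>i. Z i \<omega>) \<noteq> {}) < 1" (is "?r < 1")
proof -
  have Z0: "\<P>(\<omega> in N. Z 0 \<omega> = 0) = pmf \<mu> 0"
    using iid by (simp add: iid_with_law_def)
  have return: "(\<exists>k\<ge>1. exchange_process Z (0 + k) \<omega> = 0) \<longleftrightarrow> renewal_set (\<lambda>i. Z (Suc 0 + i) \<omega>) \<noteq> {}"
    if "Z 0 \<omega> = 0" for \<omega>
  proof -
    have "0 \<in> renewal_set (\<lambda>i. Z i \<omega>)"
      using that by (simp add: renewal_set_def)
    then have "exchange_process Z (Suc k) \<omega> = 0 \<longleftrightarrow> k \<in> renewal_set (\<lambda>i. Z (Suc 0 + i) \<omega>)" for k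
      unfolding exchange_process_eq_0_iff using renewal_set_after[of 0 "\<lambda>i. Z i \<omega>" k] by simp
    moreover have "(\<exists>k\<ge>1. exchange_process Z (0 + k) \<omega> = 0) \<longleftrightarrow> (\<exists>k. exchange_process Z (Suc k) \<omega> = 0)"
      by (metis Suc_le_D add_0 One_nat_def le_add1 plus_1_eq_Suc)
    ultimately show ?thesis
      by blast
  qed
  have "\<P>(\<omega> in N. (\<exists>k\<ge>1. exchange_process Z (0 + k) \<omega> = 0) \<and> exchange_process Z 0 \<omega> = 0) =
      \<P>(\<omega> in N. Z 0 \<omega> = 0 \<and> renewal_set (\<lambda>i. Z (Suc 0 + i) \<omega>) \<noteq> {})"
    using return by (intro arg_cong[where f = "measure N"]) auto
  also have "\<dots> = \<P>(\<omega> in N. Z 0 \<omega> = 0) * ?r"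
  proof (rule past_future_independent[OF iid])
    show "Measurable.pred (PiM UNIV (\<lambda>_. count_space UNIV)) (\<lambda>z. renewal_set z \<noteq> {})"
      unfolding ex_in_conv[symmetric] by measurable
  qed auto
  finally have "\<P>(\<omega> in N. \<exists>k\<ge>1. exchange_process Z (0 + k) \<omega> = 0 \<bar> exchange_process Z 0 \<omega> = 0) = ?r"
    using pos Z0 by (simp add: cond_prob_def)
  moreover have "0 < \<P>(\<omega> in N. exchange_process Z 0 \<omega> = 0)"
    using pos Z0 by simp
  ultimately show ?thesis
    using tr[unfolded transient_state_def, rule_format, of 0] by (simp only:)
qed

text \<open>
  Every state is treated directly, without communication of states. After time \<open>m\<close> the process can
  only come back to level \<open>x\<close> if at some later time all inputs since \<open>m\<close>, lowered by their age, have
  dropped to \<open>x\<close> or below. That is the event that the radii lowered by \<open>x\<close> leave a vertex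
  uncovered; it is independent of the state at time \<open>m\<close> and has probability less than 1.
\<close>

lemma transient_state_if_summable:
  assumes iid: "iid_with_law N \<mu> UNIV Z" and pos: "0 < pmf \<mu> 0"
    and sm: "summable (\<lambda>m. \<Prod>k=1..m. \<Sum>l<k. pmf \<mu> l)"
  shows "transient_state N (exchange_process Z) x"
  unfolding transient_state_def
proof (intro allI impI)
  interpret prob_space N by (rule iid_with_lawD[OF iid])
  fix m
  let ?X = "exchange_process Z"
  let ?p = "\<P>(\<omega> in N. ?X m \<omega> = x)"
  let ?r = "\<P>(\<omega> in N. renewal_set (\<lambda>i. Z i \<omega> - x) \<noteq> {})"
  assume p: "0 < ?p"
  have r: "?r < 1"
    using renewal_prob_less_1_iff_summable[OF iid_map[OF iid, of "\<lambda>z. z - x"]]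
      summable_truncated_law[OF pos sm] by simp
  have Zm [measurable]: "Z i \<in> measurable N (count_space UNIV)" for i
    using iid_with_lawD(3)[OF iid] by simp
  have X [measurable]: "?X m \<in> measurable N (count_space UNIV)"
    unfolding exchange_process_sequence[of Z, abs_def]
    by (rule measurable_compose[OF measurable_sequence[OF iid] measurable_exchange_process])
  have return: "renewal_set (\<lambda>i. Z (Suc m + i) \<omega> - x) \<noteq> {}" if "1 \<le> k" "?X (m + k) \<omega> = x" for k \<omega>
  proof -
    have "\<forall>j\<le>m + k. Z j \<omega> \<le> (m + k - j) + x"
      using exchange_process_le_iff[of Z "m + k" \<omega> x] that by simp
    then have "Z (Suc m + i) \<omega> - x \<le> k - 1 - i" if "i \<le> k - 1" for i
      using that \<open>1 \<le> k\<close> by (auto dest!: spec[of _ "Suc m + i"])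
    then have "k - 1 \<in> renewal_set (\<lambda>i. Z (Suc m + i) \<omega> - x)"
      by (simp add: renewal_set_def)
    then show ?thesis
      by blast
  qed
  have "\<P>(\<omega> in N. (\<exists>k\<ge>1. ?X (m + k) \<omega> = x) \<and> ?X m \<omega> = x) \<le>
      \<P>(\<omega> in N. ?X m \<omega> = x \<and> renewal_set (\<lambda>i. Z (Suc m + i) \<omega> - x) \<noteq> {})"
  proof (rule finite_measure_mono)
    show "{\<omega> \<in> space N. ?X m \<omega> = x \<and> renewal_set (\<lambda>i. Z (Suc m + i) \<omega> - x) \<noteq> {}} \<in> events"
      unfolding ex_in_conv[symmetric] renewal_set_def mem_Collect_eq by measurable
  qed (use return in blast)
  also have "\<dots> = ?p * ?r"
    unfolding exchange_process_sequence[of Z]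
  proof (rule past_future_independent[OF iid])
    show "Measurable.pred (PiM UNIV (\<lambda>_. count_space UNIV)) (\<lambda>z. exchange_process (\<lambda>i z. z i) m z = x)"
      using measurable_exchange_process[of m] by measurable
    show "Measurable.pred (PiM UNIV (\<lambda>_. count_space UNIV)) (\<lambda>z. renewal_set (\<lambda>i. z i - x) \<noteq> {})"
      unfolding ex_in_conv[symmetric] renewal_set_def mem_Collect_eq by measurable
  qed (simp cong: exchange_process_cong)
  also have "\<dots> < ?p"
    using p r by simp
  finally show "\<P>(\<omega> in N. \<exists>k\<ge>1. ?X (m + k) \<omega> = x \<bar> ?X m \<omega> = x) < 1"
    using p by (simp add: cond_prob_def)
qed

section \<open>Directed paths in the lattice\<close>

text \<open>
  Every step raises the coordinate sum by one, so all paths between two points have the same length,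
  and no separate notion of shortest path is needed.
\<close>

lemma lattice_path_le:
  assumes "(x, y) \<in> lattice_edges n ^^ k" "x \<in> lattice_verts n"
  shows "y \<in> lattice_verts n \<and> (\<forall>i<n. x ! i \<le> y ! i) \<and> sum_list y = sum_list x + k"
  using assms
proof (induction k arbitrary: y)
  case (Suc k)
  then obtain w where w: "(x, w) \<in> lattice_edges n ^^ k" and wy: "(w, y) \<in> lattice_edges n"
    by auto
  from wy obtain j where j: "j < n" "y = w[j := Suc (w ! j)]"
    by (auto simp: lattice_edges_def)
  have IH: "length w = n" "\<forall>i<n. x ! i \<le> w ! i" "sum_list w = sum_list x + k"
    using Suc.IH[OF w Suc.prems(2)] by (auto simp: lattice_verts_def)
  have "w ! j \<le> sum_list w"
    using j IH by (intro member_le_sum_list) auto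
  then have "sum_list y = Suc (sum_list w)"
    using j IH by (simp add: sum_list_update)
  then show ?case
    using j IH by (auto simp: lattice_verts_def nth_list_update le_SucI)
qed auto

lemma lattice_line_path:
  assumes "length y = n" "i < n"
  shows "(y[i := a], y[i := a + k]) \<in> lattice_edges n ^^ k"
proof (induction k)
  case (Suc k)
  have "(y[i := a + k], y[i := a + Suc k]) \<in> lattice_edges n"
    unfolding lattice_edges_def using assms
    by (auto simp: lattice_verts_def intro!: exI[of _ "y[i := a + k]"] exI[of _ i])
  with Suc show ?case
    by auto
qed auto

lemma mem_graph_ball_iff:
  "y \<in> graph_ball V E r x \<longleftrightarrow> y \<in> V \<and> (\<exists>k<r. (x, y) \<in> E ^^ k)"
  by (auto simp: graph_ball_def graph_dist_def INF_less_iff)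

lemma mem_lattice_uncovered_iff:
  "y \<in> lattice_uncovered n r \<longleftrightarrow>
    y \<in> lattice_verts n \<and> (\<forall>x\<in>lattice_verts n. \<forall>k. (x, y) \<in> lattice_edges n ^^ k \<longrightarrow> r x \<le> k)"
  by (auto simp: lattice_uncovered_def uncovered_def covered_def mem_graph_ball_iff not_less)

text \<open>
  No directed path enters the first coordinate axis from outside, so the covering process on \<open>n\<close>
  dimensions restricted to the axis is exactly the one-dimensional process.
\<close>

definition axis_point :: "nat \<Rightarrow> nat \<Rightarrow> nat list" where
  "axis_point n m = m # replicate (n - 1) 0"

lemma inj_axis_point: "inj (axis_point n)"
  by (auto simp: axis_point_def inj_on_def)

lemma axis_point_in_lattice_verts: "1 \<le> n \<Longrightarrow> axis_point n m \<in> lattice_verts n"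
  by (simp add: axis_point_def lattice_verts_def)

lemma lattice_path_to_axis:
  assumes n: "1 \<le> n"
  shows "x \<in> lattice_verts n \<and> (x, axis_point n m) \<in> lattice_edges n ^^ k \<longleftrightarrow>
    (\<exists>j\<le>m. x = axis_point n j \<and> k = m - j)"
proof
  assume x: "x \<in> lattice_verts n \<and> (x, axis_point n m) \<in> lattice_edges n ^^ k"
  then have len: "length x = n" and le: "\<forall>i<n. x ! i \<le> axis_point n m ! i"
    and sum: "sum_list (axis_point n m) = sum_list x + k"
    using lattice_path_le[of x "axis_point n m" k n] by (auto simp: lattice_verts_def)
  have "x = axis_point n (x ! 0)"
  proof (rule nth_equalityI)
    show "length x = length (axis_point n (x ! 0))"
      using len n by (simp add: axis_point_def)
    show "x ! i = axis_point n (x ! 0) ! i" if "i < length x" for i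
      using le len that by (cases i) (force simp: axis_point_def)+
  qed
  moreover have "x ! 0 \<le> m"
    using le n by (auto simp: axis_point_def)
  moreover have "sum_list (axis_point n j) = j" for j
    by (simp add: axis_point_def sum_list_replicate)
  ultimately show "\<exists>j\<le>m. x = axis_point n j \<and> k = m - j"
    using sum by (metis add_diff_cancel_left')
next
  assume "\<exists>j\<le>m. x = axis_point n j \<and> k = m - j"
  then obtain j where "j \<le> m" "x = axis_point n j" "k = m - j"
    by blast
  then show "x \<in> lattice_verts n \<and> (x, axis_point n m) \<in> lattice_edges n ^^ k"
    using n lattice_line_path[of "axis_point n 0" n 0 j k] by (simp add: axis_point_def lattice_verts_def)
qed

lemma axis_point_uncovered_iff:
  assumes "1 \<le> n"
  shows "axis_point n m \<in> lattice_uncovered n r \<longleftrightarrow> m \<in> renewal_set (\<lambda>k. r (axis_point n k))"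
proof -
  have "axis_point n m \<in> lattice_uncovered n r \<longleftrightarrow>
      (\<forall>x k. x \<in> lattice_verts n \<and> (x, axis_point n m) \<in> lattice_edges n ^^ k \<longrightarrow> r x \<le> k)"
    using axis_point_in_lattice_verts[OF assms] by (auto simp: mem_lattice_uncovered_iff)
  also have "\<dots> \<longleftrightarrow> (\<forall>j\<le>m. r (axis_point n j) \<le> m - j)"
    unfolding lattice_path_to_axis[OF assms] by blast
  finally show ?thesis
    by (simp add: renewal_set_def)
qed

lemma axis_renewals_subset_uncovered:
  assumes "1 \<le> n"
  shows "axis_point n ` renewal_set (\<lambda>k. r (axis_point n k)) \<subseteq> lattice_uncovered n r"
  using axis_point_uncovered_iff[OF assms] by auto

lemma ext_card_lattice_uncovered_1:
  "ext_card (lattice_uncovered 1 r) = ext_card (renewal_set (\<lambda>k. r (axis_point 1 k)))"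
proof -
  have "\<exists>m. y = axis_point 1 m" if "y \<in> lattice_verts 1" for y
    using that by (auto simp: lattice_verts_def axis_point_def length_Suc_conv)
  then have "\<exists>m. y = axis_point 1 m" if "y \<in> lattice_uncovered 1 r" for y
    using that by (simp add: mem_lattice_uncovered_iff)
  moreover have "axis_point 1 m \<in> lattice_uncovered 1 r \<longleftrightarrow> m \<in> renewal_set (\<lambda>k. r (axis_point 1 k))" for m
    by (rule axis_point_uncovered_iff) simp
  ultimately have "lattice_uncovered 1 r = axis_point 1 ` renewal_set (\<lambda>k. r (axis_point 1 k))"
    by blast
  moreover have "inj_on (axis_point 1) A" for A
    using inj_axis_point by (rule inj_on_subset) simp
  ultimately show ?thesis
    by (simp add: ext_card_def finite_image_iff card_image)
qed

section \<open>Uncovered vertices of the lattice\<close>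

lemma iid_axis:
  assumes "iid_with_law M \<mu> (lattice_verts n) Y" "1 \<le> n"
  shows "iid_with_law M \<mu> UNIV (\<lambda>k. Y (axis_point n k))"
  using assms(1) by (rule iid_reindex) (use assms(2) inj_axis_point axis_point_in_lattice_verts in auto)

lemma pred_lattice_uncovered:
  assumes iid: "iid_with_law M \<mu> (lattice_verts n) Y"
  shows "Measurable.pred M (\<lambda>\<omega>. y \<in> lattice_uncovered n (\<lambda>x. Y x \<omega>))"
proof -
  have "Measurable.pred M (\<lambda>\<omega>. \<forall>x\<in>lattice_verts n. \<forall>k. (x, y) \<in> lattice_edges n ^^ k \<longrightarrow> Y x \<omega> \<le> k)"
  proof (intro pred_intros_countable_bounded)
    fix x
    assume "x \<in> lattice_verts n"
    note [measurable] = iid_with_lawD(3)[OF iid this]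
    show "Measurable.pred M (\<lambda>\<omega>. \<forall>k. (x, y) \<in> lattice_edges n ^^ k \<longrightarrow> Y x \<omega> \<le> k)"
      by measurable
  qed
  then show ?thesis
    unfolding mem_lattice_uncovered_iff by (cases "y \<in> lattice_verts n") simp_all
qed

text \<open>
  The probability that none of the \<open>t\<close> points at distances \<open>t, ..., 1\<close> before a vertex on an
  axis-parallel line covers that vertex. The vertex itself is left out, so that the lines in the
  different directions through the vertex are disjoint.
\<close>

definition line_weight :: "nat pmf \<Rightarrow> nat \<Rightarrow> real" where
  "line_weight \<mu> t = (\<Prod>j<t. \<Sum>l\<le>t - j. pmf \<mu> l)"

lemma line_weight_nonneg: "0 \<le> line_weight \<mu> t"
  unfolding line_weight_def by (intro prod_nonneg sum_nonneg) auto

lemma summable_line_weight: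
  assumes pos: "0 < pmf \<mu> 0" and sm: "summable (\<lambda>m. \<Prod>k=1..m. \<Sum>l<k. pmf \<mu> l)"
  shows "summable (line_weight \<mu>)"
proof -
  have "line_weight \<mu> t * pmf \<mu> 0 = (\<Prod>k=1..Suc t. \<Sum>l<k. pmf \<mu> l)" for t
  proof -
    have "line_weight \<mu> t * pmf \<mu> 0 = (\<Prod>j\<in>{..t}. \<Sum>l\<le>t - j. pmf \<mu> l)"
      by (simp add: line_weight_def lessThan_Suc_atMost[symmetric])
    then show ?thesis
      by (simp only: prod_reversed)
  qed
  moreover have "summable (\<lambda>m. \<Prod>k=1..Suc m. \<Sum>l<k. pmf \<mu> l)"
    using sm by (subst summable_Suc_iff)
  ultimately have "summable (\<lambda>t. line_weight \<mu> t * pmf \<mu> 0)"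
    by simp
  then show ?thesis
    using pos summable_cmult_iff[of "pmf \<mu> 0" "line_weight \<mu>"] by (simp add: mult.commute)
qed

text \<open>
  Only the points from which the vertex can be reached along an axis-parallel line are taken into
  account. Points on different lines are distinct, so independence turns the bound into a product
  over the coordinates.
\<close>

lemma prob_lattice_uncovered_le:
  assumes iid: "iid_with_law M \<mu> (lattice_verts n) Y" and y: "y \<in> lattice_verts n"
  shows "\<P>(\<omega> in M. y \<in> lattice_uncovered n (\<lambda>x. Y x \<omega>)) \<le> (\<Prod>i<n. line_weight \<mu> (y ! i))"
proof -
  interpret prob_space M by (rule iid_with_lawD[OF iid])
  let ?I = "SIGMA i:{..<n}. {..<y ! i}"
  let ?x = "\<lambda>(i, j). y[i := j]"
  let ?c = "\<lambda>x. sum_list y - sum_list x"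
  have len: "length y = n"
    using y by (simp add: lattice_verts_def)
  have verts: "?x ` ?I \<subseteq> lattice_verts n"
    using len by (auto simp: lattice_verts_def)
  have inj: "inj_on ?x ?I"
  proof (rule inj_onI, clarify)
    fix i j i' j'
    assume *: "i < n" "j < y ! i" "i' < n" "j' < y ! i'" "y[i := j] = y[i' := j']"
    have "i = i'"
    proof (rule ccontr)
      assume "i \<noteq> i'"
      then have "y[i' := j'] ! i = y ! i"
        by simp
      moreover have "y[i := j] ! i = j"
        using *(1) len by (intro nth_list_update_eq) simp
      ultimately show False
        using * by simp
    qed
    with * len show "i = i' \<and> j = j'"
      by (metis nth_list_update_eq)
  qed
  have c: "?c (y[i := j]) = y ! i - j" if "i < n" "j < y ! i" for i j
  proof -
    have "y ! i \<le> sum_list y"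
      using that len by (intro member_le_sum_list) auto
    then show ?thesis
      using that len by (simp add: sum_list_update)
  qed
  have le: "Y x \<omega> \<le> ?c x" if unc: "y \<in> lattice_uncovered n (\<lambda>x. Y x \<omega>)" and x: "x \<in> ?x ` ?I" for x \<omega>
  proof -
    obtain i j where ij: "i < n" "j < y ! i" "x = y[i := j]"
      using x by auto
    have "(x, y[i := j + (y ! i - j)]) \<in> lattice_edges n ^^ (y ! i - j)"
      unfolding ij(3) by (rule lattice_line_path) (use len ij in auto)
    then have "(x, y) \<in> lattice_edges n ^^ (y ! i - j)"
      using ij by simp
    then show ?thesis
      using unc x verts ij c[OF ij(1,2)] by (auto simp: mem_lattice_uncovered_iff)
  qed
  have "\<P>(\<omega> in M. y \<in> lattice_uncovered n (\<lambda>x. Y x \<omega>)) \<le> \<P>(\<omega> in M. \<forall>x\<in>?x ` ?I. Y x \<omega> \<le> ?c x)"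
  proof (rule finite_measure_mono)
    have "Measurable.pred M (\<lambda>\<omega>. \<forall>x\<in>?x ` ?I. Y x \<omega> \<le> ?c x)"
    proof (intro pred_intros_countable_bounded)
      fix x
      assume "x \<in> ?x ` ?I"
      then have [measurable]: "Y x \<in> measurable M (count_space UNIV)"
        using iid_with_lawD(3)[OF iid] verts by blast
      show "Measurable.pred M (\<lambda>\<omega>. Y x \<omega> \<le> ?c x)"
        by measurable
    qed
    then show "{\<omega> \<in> space M. \<forall>x\<in>?x ` ?I. Y x \<omega> \<le> ?c x} \<in> events"
      by (simp add: pred_def)
  qed (use le in blast)
  also have "\<dots> = (\<Prod>x\<in>?x ` ?I. \<Sum>l\<le>?c x. pmf \<mu> l)"
    by (rule iid_prob_all_le[OF iid verts]) auto
  also have "\<dots> = (\<Prod>(i, j)\<in>?I. \<Sum>l\<le>y ! i - j. pmf \<mu> l)"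
    by (subst prod.reindex[OF inj]) (auto intro!: prod.cong simp: c)
  also have "\<dots> = (\<Prod>i<n. line_weight \<mu> (y ! i))"
    unfolding line_weight_def by (rule prod.Sigma[symmetric]) auto
  finally show ?thesis .
qed

lemma nn_integral_count_space_restrict:
  "integral\<^sup>N (count_space X) f = (\<integral>\<^sup>+x. f x * indicator X x \<partial>count_space UNIV)"
  by (rule nn_integral_count_space_indicator) simp_all

lemma nn_integral_lattice_prod:
  fixes f :: "nat \<Rightarrow> ennreal"
  shows "(\<integral>\<^sup>+y. (\<Prod>i<n. f (y ! i)) \<partial>count_space (lattice_verts n)) = (\<Sum>m. f m) ^ n"
proof (induction n)
  case 0
  have "lattice_verts 0 = {[]}"
    by (auto simp: lattice_verts_def)
  then show ?case
    by (simp add: nn_integral_count_space_finite)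
next
  case (Suc n)
  let ?V = "lattice_verts n"
  let ?cons = "\<lambda>(a, ys). a # ys"
  have "lattice_verts (Suc n) = ?cons ` (UNIV \<times> ?V)"
    by (auto simp: lattice_verts_def length_Suc_conv image_iff)
  moreover have "inj_on ?cons (UNIV \<times> ?V)"
    by (auto simp: inj_on_def)
  ultimately have "(\<integral>\<^sup>+y. (\<Prod>i<Suc n. f (y ! i)) \<partial>count_space (lattice_verts (Suc n))) =
      (\<integral>\<^sup>+p. (\<Prod>i<Suc n. f (?cons p ! i)) \<partial>count_space (UNIV \<times> ?V))"
    by (simp add: nn_integral_bij_count_space[OF inj_on_imp_bij_betw, symmetric])
  also have "\<dots> = (\<integral>\<^sup>+p. f (fst p) * (\<Prod>i<n. f (snd p ! i)) * indicator (UNIV \<times> ?V) p \<partial>count_space UNIV)"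
    unfolding nn_integral_count_space_restrict[of "UNIV \<times> ?V"]
    by (intro nn_integral_cong) (auto simp: prod.lessThan_Suc_shift simp del: prod.lessThan_Suc)
  also have "\<dots> = (\<integral>\<^sup>+a. \<integral>\<^sup>+ys. f a * ((\<Prod>i<n. f (ys ! i)) * indicator ?V ys) \<partial>count_space UNIV \<partial>count_space UNIV)"
    by (subst nn_integral_fst_count_space[symmetric])
      (auto intro!: nn_integral_cong simp: indicator_def mult.assoc)
  also have "\<dots> = (\<integral>\<^sup>+a. f a * (\<Sum>m. f m) ^ n \<partial>count_space UNIV)"
    by (simp add: nn_integral_cmult nn_integral_count_space_restrict[of "lattice_verts n", symmetric] Suc.IH)
  also have "\<dots> = (\<Sum>m. f m) ^ Suc n"
    by (simp add: nn_integral_multc nn_integral_count_space_nat)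
  finally show ?case .
qed

text \<open>
  The bound on the probability that a vertex is uncovered is a product over its coordinates, so
  the sum over all vertices is at most the \<open>n\<close>-th power of a one-dimensional sum, which
  condition \<open>d\<close> makes finite.
\<close>

lemma expected_uncovered_finite:
  assumes iid: "iid_with_law M \<mu> (lattice_verts n) Y" and pos: "0 < pmf \<mu> 0"
    and sm: "summable (\<lambda>m. \<Prod>k=1..m. \<Sum>l<k. pmf \<mu> l)"
  shows "(\<integral>\<^sup>+\<omega>. ennreal_of_enat (ext_card (lattice_uncovered n (\<lambda>x. Y x \<omega>))) \<partial>M) < \<infinity>"
proof -
  interpret prob_space M by (rule iid_with_lawD[OF iid])
  let ?U = "\<lambda>\<omega>. lattice_uncovered n (\<lambda>x. Y x \<omega>)"
  have bound: "emeasure M {\<omega>\<in>space M. y \<in> ?U \<omega>} \<le>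
      (\<Prod>i<n. ennreal (line_weight \<mu> (y ! i))) * indicator (lattice_verts n) y" for y
  proof (cases "y \<in> lattice_verts n")
    case True
    then show ?thesis
      using prob_lattice_uncovered_le[OF iid True]
      by (simp add: emeasure_eq_measure prod_ennreal line_weight_nonneg ennreal_leI)
  next
    case False
    then show ?thesis
      by (simp add: mem_lattice_uncovered_iff)
  qed
  have "(\<integral>\<^sup>+\<omega>. ennreal_of_enat (ext_card (?U \<omega>)) \<partial>M) =
      (\<integral>\<^sup>+y. emeasure M {\<omega>\<in>space M. y \<in> ?U \<omega>} \<partial>count_space UNIV)"
    by (rule nn_integral_ext_card[OF pred_lattice_uncovered[OF iid]])
  also have "\<dots> \<le> (\<integral>\<^sup>+y. (\<Prod>i<n. ennreal (line_weight \<mu> (y ! i))) * indicator (lattice_verts n) y \<partial>count_space UNIV)"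
    by (intro nn_integral_mono bound)
  also have "\<dots> = (\<Sum>m. ennreal (line_weight \<mu> m)) ^ n"
    unfolding nn_integral_count_space_restrict[of "lattice_verts n", symmetric]
    by (rule nn_integral_lattice_prod)
  also have "\<dots> < \<infinity>"
    using summable_line_weight[OF pos sm] line_weight_nonneg[of \<mu>]
    by (simp add: suminf_ennreal2 power_less_top_ennreal)
  finally show ?thesis .
qed

section \<open>Equivalence of finiteness, transience and convergence\<close>

theorem theorem2:
  fixes \<mu> :: "nat pmf"
    and M :: "nat \<Rightarrow> 'a measure"
    and Y :: "nat \<Rightarrow> nat list \<Rightarrow> 'a \<Rightarrow> nat"
    and N :: "'b measure"
    and Z :: "nat \<Rightarrow> 'b \<Rightarrow> nat"
  assumes "0 < pmf \<mu> 0" and "pmf \<mu> 0 < 1"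
    and "\<And>n. n \<ge> 1 \<Longrightarrow> iid_with_law (M n) \<mu> (lattice_verts n) (Y n)"
    and "iid_with_law N \<mu> UNIV Z"
  shows
    "let U = (\<lambda>n \<omega>. ext_card (lattice_uncovered n (\<lambda>x. Y n x \<omega>)));
         a = (\<exists>n\<ge>1. AE \<omega> in M n. U n \<omega> < \<infinity>);
         b = (\<forall>n\<ge>1. AE \<omega> in M n. U n \<omega> < \<infinity>);
         c = transient_chain N (exchange_states \<mu>) (exchange_process Z);
         d = summable (\<lambda>m. \<Prod>k=1..m. \<Sum>l<k. pmf \<mu> l)
     in (a \<longleftrightarrow> b) \<and> (b \<longleftrightarrow> c) \<and> (c \<longleftrightarrow> d) \<and>
        (a \<or> b \<or> c \<or> d \<longrightarrow>
           (\<forall>n\<ge>1. (\<integral>\<^sup>+ \<omega>. ennreal_of_enat (U n \<omega>) \<partial>M n) < \<infinity>) \<and>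
           (\<exists>\<alpha>>0. (\<integral>\<^sup>+ \<omega>. exp_mult_enat \<alpha> (U 1 \<omega>) \<partial>M 1) < \<infinity>))"
proof -
  let ?U = "\<lambda>n \<omega>. ext_card (lattice_uncovered n (\<lambda>x. Y n x \<omega>))"
  let ?fin = "\<lambda>n. AE \<omega> in M n. ?U n \<omega> < \<infinity>"
  let ?c = "transient_chain N (exchange_states \<mu>) (exchange_process Z)"
  let ?d = "summable (\<lambda>m. \<Prod>k=1..m. \<Sum>l<k. pmf \<mu> l)"
  note pos = assms(1) and iid = assms(3) and iidZ = assms(4)
  have d_if_fin: ?d if n: "1 \<le> n" and fin: "?fin n" for n
  proof -
    have "AE \<omega> in M n. finite (renewal_set (\<lambda>k. Y n (axis_point n k) \<omega>))"
      using fin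
    proof eventually_elim
      case (elim \<omega>)
      then have "finite (lattice_uncovered n (\<lambda>x. Y n x \<omega>))"
        by (simp add: ext_card_def split: if_splits)
      then have "finite (axis_point n ` renewal_set (\<lambda>k. Y n (axis_point n k) \<omega>))"
        by (rule finite_subset[OF axis_renewals_subset_uncovered[OF n]])
      then show ?case
        using inj_axis_point by (rule finite_imageD[OF _ inj_on_subset]) simp
    qed
    then show ?d
      using AE_finite_renewals_iff_summable[OF iid_axis[OF iid[OF n] n]] by blast
  qed
  have expectation: "(\<integral>\<^sup>+ \<omega>. ennreal_of_enat (?U n \<omega>) \<partial>M n) < \<infinity>" if ?d "1 \<le> n" for n
    using expected_uncovered_finite[OF iid[OF that(2)] pos that(1)] .
  then have fin_if_d: "?fin n" if ?d "1 \<le> n" for n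
    using that AE_ext_card_finite[OF pred_lattice_uncovered[OF iid[OF that(2)]]] by blast
  have c_iff_d: "?c \<longleftrightarrow> ?d"
  proof
    assume ?c
    moreover have "0 \<in> exchange_states \<mu>"
      by (simp add: exchange_states_def)
    ultimately have "transient_state N (exchange_process Z) 0"
      unfolding transient_chain_def by blast
    then show ?d
      using transient_state_0_imp_renewal_prob_less_1[OF iidZ pos]
        renewal_prob_less_1_iff_summable[OF iidZ] by blast
  next
    assume ?d
    then show ?c
      using transient_state_if_summable[OF iidZ pos] by (simp add: transient_chain_def)
  qed
  have exponential: "\<exists>\<alpha>>0. (\<integral>\<^sup>+ \<omega>. exp_mult_enat \<alpha> (?U 1 \<omega>) \<partial>M 1) < \<infinity>" if ?d
  proof -
    have iid1: "iid_with_law (M 1) \<mu> UNIV (\<lambda>k. Y 1 (axis_point 1 k))"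
      using iid[of 1] by (intro iid_axis) auto
    show ?thesis
      using renewals_exponential_moment[OF iid1] renewal_prob_less_1_iff_summable[OF iid1] that
      unfolding ext_card_lattice_uncovered_1 by blast
  qed
  have one: "(1::nat) \<le> 1"
    by simp
  have a_iff_b: "(\<exists>n\<ge>1. ?fin n) \<longleftrightarrow> (\<forall>n\<ge>1. ?fin n)" and b_iff_d: "(\<forall>n\<ge>1. ?fin n) \<longleftrightarrow> ?d"
    using d_if_fin fin_if_d one by blast+
  show ?thesis
    unfolding Let_def
  proof (intro conjI impI)
    show "(\<exists>n\<ge>1. ?fin n) \<longleftrightarrow> (\<forall>n\<ge>1. ?fin n)" and "?c \<longleftrightarrow> ?d"
      by (fact a_iff_b c_iff_d)+
    show "(\<forall>n\<ge>1. ?fin n) \<longleftrightarrow> ?c"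
      by (simp only: b_iff_d c_iff_d)
    assume "(\<exists>n\<ge>1. ?fin n) \<or> (\<forall>n\<ge>1. ?fin n) \<or> ?c \<or> ?d"
    then have d: ?d
      by (simp only: a_iff_b b_iff_d c_iff_d simp_thms)
    show "\<forall>n\<ge>1. (\<integral>\<^sup>+ \<omega>. ennreal_of_enat (?U n \<omega>) \<partial>M n) < \<infinity>"
      using expectation[OF d] by blast
    show "\<exists>\<alpha>>0. (\<integral>\<^sup>+ \<omega>. exp_mult_enat \<alpha> (?U 1 \<omega>) \<partial>M 1) < \<infinity>"
      by (rule exponential[OF d])
  qed
qed

end
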